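(* Let $[g]$ be an equivalence class (under time-rescaling) in $\mathcal{G}$, and assume that there exists a $1$-essential dynamics $g_1\in[g]$. Let $\alpha$ be a time-rescaling function such that $\dot\alpha$ is monotonic, and put $$\hat g[f](y,t):=\dot\alpha(t)\,g_1[f](y,\alpha(t)).$$ A fixed numerical method with stability domain $S$ is applied, with step sizes $h_k>0$ ($k\ge 1$) and accumulated times $t_0=0$, $t_k=\sum_{i=1}^k h_i$, to the initial value problems $\dot y=\hat g[f](y,t)$, $y(0)=y_0$, with $(f,y_0)\in\mathcal{F}\times\mathcal{V}$. The same method is used throughout the integration, and the sequence $\{h_k\}$ is common to all $(f,y_0)$. Let $\{y^{(k)}_{\hat g[f],y_0}\}_{k\ge 0}$ be the resulting numerical solution, where $y^{(k)}_{\hat g[f],y_0}$ is the numerical value at time $t_k$ and $y^{(0)}_{\hat g[f],y_0}=y_0$. Assume: (i) the stability domain $S$ is bounded, i.e. $r:=\max_{z\in S}|z|<+\infty$, and static (it does not change with time); (ii) for every $f\in\mathcal{F}$ and $y_0\in\mathcal{V}$, and every $k\ge1$, all the eigenvalues of $h_k\,\frac{\partial \hat g[f]}{\partial y}\bigl(y^{(k-1)}_{\hat g[f],y_0},t_{k-1}\bigr)$ lie in $S$; moreover $t_k\to\infty$ as $k\to\infty$; (iii) for every $\varepsilon_0>0$ there exist $\tilde f\in\mathcal{F}$, $\tilde y_0\in\mathcal{V}$ and $k_0>0$ such that for all $k\ge k_0$ $$\rho\left(\frac{\partial g_1[\tilde f]}{\partial y}\bigl(y^{(k)}_{\hat g[\tilde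 f],\tilde y_0},\alpha(t_k)\bigr)\right)\ge 1-\varepsilon_0 .$$ Then for every $\varepsilon>0$ there exists an infinite subsequence of times $\{t_{\ell_j}\}_j$ of $\{t_k\}_k$ such that $$\alpha(t_{\ell_j})\le r\,\ell_j+\varepsilon\,\ell_j\qquad\text{for all } j .$$
   Context: Setting. $\mathcal{F}$ is a collection of objective functions $f:\mathbb{R}^d\to\mathbb{R}$, each having a (possibly local) optimal value $f^\star$ attained at an optimal solution $x^\star$. Let $d'\in\{d,2d,\dots\}$ and let $\mathcal{V}\subseteq\mathbb{R}^{d'}$ be a set of initial values. The first $d$ coordinates of $y\in\mathbb{R}^{d'}$ are the original variables $x$ and the others are auxiliary; $f$ is extended to $\mathbb{R}^{d'}$ by $f(y):=f(y_1,\dots,y_d)$. $\mathcal{G}$ denotes the collection of maps $g[\cdot]$ assigning to each $f\in\mathcal{F}$ a vector field $g[f]:\mathbb{R}^{d'}\times\mathbb{R}_{\ge0}\to\mathbb{R}^{d'}$ such that, for all $f\in\mathcal{F}$ and $y_0\in\mathcal{V}$, the ODE $\dot y=g[f](y,t)$, $y(0)=y_0$, is globally well-posed and its solution, denoted $y_{g[f],y_0}(t)$, satisfies $f(y(t))\to f^\star$ as $t\to\infty$. The Jacobian $\partial g[f]/\partial y$ with respect to the first argument is assumed to exist where it is used. $\rho(A)$ denotes the spectral radius of a matrix $A$. Time-rescaling function: a function $\alpha:\mathbb{R}_{\ge0}\to\mathbb{R}_{\ge0}$ that is differentiable, monotonically increasing, with $\alpha(0)=0$ and $\lim_{t\to\infty}\alpha(t)=\infty$.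 Equivalence: for $g,g'\in\mathcal{G}$, $g\sim g'$ means that there is a time-rescaling function $\alpha$ with $g[f](y,t)=\dot\alpha(t)\,g'[f](y,\alpha(t))$ for all $t>0$, $y\in\mathbb{R}^{d'}$, $f\in\mathcal{F}$. The equivalence class of $g$ is denoted $[g]$. $c$-essential dynamics: for $g\in\mathcal{G}$ let $$\mathcal{L}_g:=\Bigl\{(f,y_0)\in\mathcal{F}\times\mathcal{V}\ :\ \lim_{t\to\infty}\rho\Bigl(\tfrac{\partial g[f]}{\partial y}(y_{g[f],y_0}(t),t)\Bigr)\text{ exists}\Bigr\}.$$ For $c>0$, $g$ is called $c$-essential if $\mathcal{L}_g\ne\emptyset$ and $$c=\sup_{(f,y_0)\in\mathcal{F}\times\mathcal{V}}\ \limsup_{t\to\infty}\rho\Bigl(\tfrac{\partial g[f]}{\partial y}(y_{g[f],y_0}(t),t)\Bigr)=\sup_{(f,y_0)\in\mathcal{L}_g}\ \lim_{t\to\infty}\rho\Bigl(\tfrac{\partial g[f]}{\partial y}(y_{g[f],y_0}(t),t)\Bigr).$$ Stability domain: for a numerical method for ODEs, let $R(\lambda h)$ be the value obtained by applying one step of the method with step size $h$ to the test equation $\dot x=\lambda x$, $x(0)=1$. $R$ is the stability function and $S:=\{z\in\mathbb{C}: |R(z)|\le1\}$ is the stability domain of the method. *)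

theory Defs
  imports "HOL-Analysis.Analysis" "Jordan_Normal_Form.Spectral_Radius"
begin


section \<open>Coordinates\<close>

text \<open>
  Euclidean spaces are types \<open>real ^ 'n\<close> with \<open>'n :: enum\<close>, so that the coordinates come with a fixed
  numbering \<open>enum ! 0, ..., enum ! (CARD('n) - 1)\<close>. Through it, vectors and matrices are read as
  objects of \<open>Jordan_Normal_Form.Matrix\<close>, whose dimension is not part of the type; this gives access
  to the spectrum and spectral radius of that library, and to numerical methods that work in all
  dimensions at once.
\<close>

definition coord_index :: "'n::enum \<Rightarrow> nat" where
  "coord_index i = (THE k. k < CARD('n) \<and> (Enum.enum :: 'n list) ! k = i)"

definition to_dvec :: "real ^ 'n::enum \<Rightarrow> real Matrix.vec" where
  "to_dvec y = Matrix.vec CARD('n) (\<lambda>k. vec_nth y ((Enum.enum :: 'n list) ! k))"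

definition of_dvec :: "real Matrix.vec \<Rightarrow> real ^ 'n::enum" where
  "of_dvec v = (\<chi> i. Matrix.vec_index v (coord_index i))"

definition to_cmat :: "real ^ 'n::enum ^ 'n::enum \<Rightarrow> complex Matrix.mat" where
  "to_cmat A = Matrix.mat CARD('n) CARD('n)
     (\<lambda>(i, j). complex_of_real
        (vec_nth (vec_nth A ((Enum.enum :: 'n list) ! i)) ((Enum.enum :: 'n list) ! j)))"

text \<open>The first \<open>d\<close> coordinates of a point of the extended space.\<close>

definition orig_vars :: "real ^ 'n::enum \<Rightarrow> real ^ 'd::enum" where
  "orig_vars y = of_dvec (vec_first (to_dvec y) CARD('d))"

lemma length_enum_card: "length (Enum.enum :: 'n::enum list) = CARD('n)"
  by (metis distinct_card enum_UNIV enum_distinct)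

lemma coord_index_enum:
  assumes "k < CARD('n)"
  shows "coord_index ((Enum.enum :: 'n::enum list) ! k) = k"
  unfolding coord_index_def
  by (rule the_equality) (use assms in \<open>auto simp: nth_eq_iff_index_eq enum_distinct length_enum_card\<close>)

lemma enum_coord_index:
  fixes i :: "'n::enum"
  shows "coord_index i < CARD('n)" "(Enum.enum :: 'n list) ! coord_index i = i"
proof -
  obtain k where "k < CARD('n)" "(Enum.enum :: 'n list) ! k = i"
    by (metis UNIV_I enum_UNIV in_set_conv_nth length_enum_card)
  then show "coord_index i < CARD('n)" "(Enum.enum :: 'n list) ! coord_index i = i"
    using coord_index_enum[where 'n = 'n, of k] by auto
qed

lemma of_to_dvec: "of_dvec (to_dvec y) = y"
  by (simp add: vec_eq_iff of_dvec_def to_dvec_def enum_coord_index)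

lemma to_of_dvec:
  assumes "v \<in> carrier_vec CARD('n)"
  shows "to_dvec (of_dvec v :: real ^ 'n::enum) = v"
  using assms by (intro eq_vecI) (auto simp: of_dvec_def to_dvec_def coord_index_enum)

section \<open>Objective functions and vector fields\<close>

type_synonym 'n pt = "real ^ 'n"
type_synonym 'd objective = "'d pt \<Rightarrow> real"
type_synonym 'n vfield = "'n pt \<Rightarrow> real \<Rightarrow> 'n pt"
type_synonym ('d, 'n) dynamics = "'d objective \<Rightarrow> 'n vfield"

text \<open>Optimal means minimal, and possibly only locally so.\<close>

definition objective_collection ::
  "('d::enum) objective set \<Rightarrow> ('d objective \<Rightarrow> real) \<Rightarrow> bool" where
  "objective_collection \<F> fstar \<longleftrightarrow>
     (\<forall>f\<in>\<F>. \<exists>xstar. f xstar = fstar f \<and> (\<forall>\<^sub>F x in nhds xstar. fstar f \<le> f x))"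

definition solves_ivp ::
  "('n::enum) vfield \<Rightarrow> real set \<Rightarrow> 'n pt \<Rightarrow> (real \<Rightarrow> 'n pt) \<Rightarrow> bool" where
  "solves_ivp F I y0 y \<longleftrightarrow>
     y 0 = y0 \<and> (\<forall>t\<in>I. (y has_vector_derivative F (y t) t) (at t within I))"

text \<open>A solution exists for all times \<open>t \<ge> 0\<close>, and every solution, on whatever initial interval it
  is defined, coincides with it there.\<close>

definition globally_well_posed :: "('n::enum) vfield \<Rightarrow> 'n pt \<Rightarrow> bool" where
  "globally_well_posed F y0 \<longleftrightarrow>
     (\<exists>y. solves_ivp F {0..} y0 y \<and>
       (\<forall>T>0. \<forall>z. solves_ivp F {0..<T} y0 z \<longrightarrow> (\<forall>t\<in>{0..<T}. z t = y t)))"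

text \<open>Only the values at times \<open>t \<ge> 0\<close> are meaningful.\<close>

definition trajectory :: "('n::enum) vfield \<Rightarrow> 'n pt \<Rightarrow> real \<Rightarrow> 'n pt" where
  "trajectory F y0 = (SOME y. solves_ivp F {0..} y0 y)"

definition admissible ::
  "('d::enum) objective set \<Rightarrow> ('d objective \<Rightarrow> real) \<Rightarrow> ('n::enum) pt set
    \<Rightarrow> ('d, 'n) dynamics set" where
  "admissible \<F> fstar \<V> =
     {g. \<forall>f\<in>\<F>. \<forall>y0\<in>\<V>. globally_well_posed (g f) y0 \<and>
        ((\<lambda>t. f (orig_vars (trajectory (g f) y0 t))) \<longlongrightarrow> fstar f) at_top}"

section \<open>Time rescaling\<close>

definition time_rescaling :: "(real \<Rightarrow> real) \<Rightarrow> bool" where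
  "time_rescaling \<alpha> \<longleftrightarrow>
     \<alpha> differentiable_on {0..} \<and> mono_on {0..} \<alpha> \<and> \<alpha> 0 = 0 \<and> filterlim \<alpha> at_top at_top"

text \<open>The derivative of a function on \<open>[0, \<infinity>)\<close>, one-sided at \<open>0\<close>.\<close>

definition rate :: "(real \<Rightarrow> real) \<Rightarrow> real \<Rightarrow> real" where
  "rate \<alpha> t = vector_derivative \<alpha> (at t within {0..})"

definition rescale :: "(real \<Rightarrow> real) \<Rightarrow> ('d::enum, 'n::enum) dynamics \<Rightarrow> ('d, 'n) dynamics" where
  "rescale \<alpha> g = (\<lambda>f y t. rate \<alpha> t *\<^sub>R g f y (\<alpha> t))"

text \<open>The class of \<open>g\<close> is the image of \<open>{g}\<close> under the following relation. It is reflexive, but where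
  \<open>\<alpha>'\<close> has zeros it need not be symmetric, so the direction matters: \<open>g\<close> is a rescaling of \<open>g'\<close>.\<close>

definition rescaling_rel ::
  "('d::enum) objective set \<Rightarrow> ('d objective \<Rightarrow> real) \<Rightarrow> ('n::enum) pt set
    \<Rightarrow> (('d, 'n) dynamics \<times> ('d, 'n) dynamics) set" where
  "rescaling_rel \<F> fstar \<V> =
     {(g, g'). g \<in> admissible \<F> fstar \<V> \<and> g' \<in> admissible \<F> fstar \<V> \<and>
        (\<exists>\<alpha>. time_rescaling \<alpha> \<and> (\<forall>f\<in>\<F>. \<forall>y. \<forall>t>0. g f y t = rescale \<alpha> g' f y t))}"

section \<open>Essential dynamics\<close>

definition jac :: "('n::enum) vfield \<Rightarrow> 'n pt \<Rightarrow> real \<Rightarrow> real ^ 'n::enum ^ 'n::enum" where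
  "jac F y t = jacobian (\<lambda>z. F z t) (at y)"

text \<open>\<^const>\<open>jacobian\<close> has a default value where the derivative does not exist, so existence has to
  be required separately.\<close>

definition jac_exists :: "('n::enum) vfield \<Rightarrow> 'n pt \<Rightarrow> real \<Rightarrow> bool" where
  "jac_exists F y t \<longleftrightarrow> (\<lambda>z. F z t) differentiable (at y)"

definition traj_radius :: "('n::enum) vfield \<Rightarrow> 'n pt \<Rightarrow> real \<Rightarrow> real" where
  "traj_radius F y0 t = spectral_radius (to_cmat (jac F (trajectory F y0 t) t))"

definition limit_pairs ::
  "('d::enum) objective set \<Rightarrow> ('n::enum) pt set \<Rightarrow> ('d, 'n) dynamics
    \<Rightarrow> ('d objective \<times> 'n pt) set" where
  "limit_pairs \<F> \<V> g =
     {(f, y0) \<in> \<F> \<times> \<V>. \<exists>l. (traj_radius (g f) y0 \<longlongrightarrow> l) at_top}"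

text \<open>The suprema are taken in the extended reals, since they may be infinite for a general \<open>g\<close>.\<close>

definition essential ::
  "('d::enum) objective set \<Rightarrow> ('d objective \<Rightarrow> real) \<Rightarrow> ('n::enum) pt set
    \<Rightarrow> real \<Rightarrow> ('d, 'n) dynamics \<Rightarrow> bool" where
  "essential \<F> fstar \<V> c g \<longleftrightarrow>
     c > 0 \<and> g \<in> admissible \<F> fstar \<V> \<and>
     (\<forall>f\<in>\<F>. \<forall>y0\<in>\<V>. \<forall>\<^sub>F t in at_top. jac_exists (g f) (trajectory (g f) y0 t) t) \<and>
     limit_pairs \<F> \<V> g \<noteq> {} \<and>
     ereal c = (SUP (f, y0) \<in> \<F> \<times> \<V>. Limsup at_top (\<lambda>t. ereal (traj_radius (g f) y0 t))) \<and>
     ereal c = (SUP (f, y0) \<in> limit_pairs \<F> \<V> g. ereal (Lim at_top (traj_radius (g f) y0)))"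

section \<open>Numerical methods\<close>

text \<open>
  \<open>\<Phi> F t h y\<close> is the result of one step of size \<open>h\<close> for \<open>y' = F (y, t)\<close>, started at time \<open>t\<close> in
  \<open>y\<close>. It is \<^const>\<open>None\<close> where the step is undefined, e.g. where the equation of an implicit method has
  no solution. One and the same \<open>\<Phi>\<close> serves systems of every dimension.
\<close>

type_synonym one_step_method =
  "(real Matrix.vec \<Rightarrow> real \<Rightarrow> real Matrix.vec) \<Rightarrow> real \<Rightarrow> real \<Rightarrow> real Matrix.vec
    \<Rightarrow> real Matrix.vec option"

text \<open>The complex test equation \<open>x' = \<lambda> x\<close> is a real system for the real and the imaginary part.\<close>

definition of_cpx :: "complex \<Rightarrow> real Matrix.vec" where
  "of_cpx z = vec_of_list [Re z, Im z]"

definition to_cpx :: "real Matrix.vec \<Rightarrow> complex" where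
  "to_cpx v = Complex (Matrix.vec_index v 0) (Matrix.vec_index v 1)"

definition stability_function :: "one_step_method \<Rightarrow> (complex \<Rightarrow> complex option) \<Rightarrow> bool" where
  "stability_function \<Phi> R \<longleftrightarrow>
     (\<forall>lam h. h > 0 \<longrightarrow>
        \<Phi> (\<lambda>v t. of_cpx (lam * to_cpx v)) 0 h (of_cpx 1) =
          map_option of_cpx (R (lam * complex_of_real h)))"

definition stability_domain :: "(complex \<Rightarrow> complex option) \<Rightarrow> complex set" where
  "stability_domain R = {z. \<exists>w. R z = Some w \<and> cmod w \<le> 1}"

definition numerical_solution ::
  "one_step_method \<Rightarrow> (nat \<Rightarrow> real) \<Rightarrow> (nat \<Rightarrow> real) \<Rightarrow> ('n::enum) vfield
    \<Rightarrow> 'n pt \<Rightarrow> (nat \<Rightarrow> 'n pt) \<Rightarrow> bool" where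
  "numerical_solution \<Phi> h t F y0 y \<longleftrightarrow>
     y 0 = y0 \<and>
     (\<forall>k\<ge>1. \<Phi> (\<lambda>v s. to_dvec (F (of_dvec v) s)) (t (k - 1)) (h k) (to_dvec (y (k - 1)))
              = Some (to_dvec (y k)))"

end

theory Submission
  imports Defs
begin

text \<open>
  Write \<open>p k\<close> for the derivative of \<open>\<alpha>\<close> at \<open>t k\<close>. The Jacobian of \<open>ghat\<close> at time \<open>t k\<close> is \<open>p k\<close>
  times the Jacobian of \<open>g1\<close> at time \<open>\<alpha> (t k)\<close>, so the stability requirement, applied to a problem
  for which the latter has spectral radius close to 1, gives \<open>h (k + 1) p k \<le> c\<close> for large \<open>k\<close>,
  where \<open>c\<close> is slightly larger than \<open>r\<close> (\<open>jac_rescale\<close>, \<open>spectral_radius_scaled_le\<close>).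
  What remains concerns only \<open>\<alpha>\<close> and the times \<open>t k\<close> (\<open>frequently_rescaled_time_le\<close>).

  If \<open>\<alpha>'\<close> is decreasing, then \<open>\<alpha>\<close> advances by at most \<open>h (k + 1) p k \<le> c\<close> in every step, and
  \<open>\<alpha> (t k)\<close> is at most \<open>c k\<close> up to a constant.

  If \<open>\<alpha>'\<close> is increasing, the advance is only bounded by
  \<open>h (k + 1) p (k + 1) \<le> c + c (p (k + 1) - p k) / p k\<close>, and jumps of \<open>\<alpha>'\<close> within a step can make
  it arbitrarily large. Such jumps force small steps afterwards, however, and this is where
  \<open>t k \<longlonglongrightarrow> \<infinity>\<close> enters. If \<open>\<alpha> (t k) > d k\<close> for some \<open>d > c\<close> and all large \<open>k\<close>, then the relative
  increments of \<open>p\<close> sum to at least \<open>k (d - c) / c\<close> over the first \<open>k\<close> steps, up to a constant.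
  Weighting both sides with the decreasing sequence \<open>1 / p (k + 1)\<close> preserves the inequality up to
  a constant and makes the increments telescope:
  \<open>(d - c) \<Sum> 1 / p (k + 1) \<le> c \<Sum> (1 / p k - 1 / p (k + 1)) + const\<close>, which is bounded. As
  \<open>h (k + 1) \<le> c / p k\<close>, the times \<open>t k\<close> are bounded, a contradiction
  (\<open>bounded_times_of_superlinear_growth\<close>).
\<close>

section \<open>Summation\<close>

text \<open>
  Summation by parts: the weighted sum is a combination of the partial sums with the nonnegative
  coefficients \<open>w j - w (j + 1)\<close> and \<open>w n\<close>, which add up to \<open>w 0\<close>. The induction carries the slack
  of the last partial sum along.
\<close>

lemma abel_lower_bound:
  fixes u w :: "nat \<Rightarrow> real"
  assumes "antimono w" and w_nonneg: "\<And>j. w j \<ge> 0"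
    and partial: "\<And>n. (\<Sum>j<n. u j) \<ge> - C"
  shows "(\<Sum>j<n. w j * u j) \<ge> - (C * w 0)"
proof -
  have C: "C \<ge> 0" using partial[of 0] by simp
  have "(\<Sum>j<Suc n. w j * u j) \<ge> w n * ((\<Sum>j<Suc n. u j) + C) - C * w 0" for n
  proof (induction n)
    case 0
    then show ?case by (simp add: algebra_simps)
  next
    case (Suc n)
    have "w (Suc n) * ((\<Sum>j<Suc n. u j) + C) \<le> w n * ((\<Sum>j<Suc n. u j) + C)"
      using partial[of "Suc n"] antimonoD[OF \<open>antimono w\<close>, of n "Suc n"]
      by (intro mult_right_mono) auto
    with Suc.IH show ?case
      by (simp add: algebra_simps)
  qed
  moreover have "w n * ((\<Sum>j<Suc n. u j) + C) \<ge> 0" for n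
    using partial[of "Suc n"] w_nonneg[of n] by (intro mult_nonneg_nonneg) auto
  ultimately have "(\<Sum>j<Suc n. w j * u j) \<ge> - (C * w 0)" for n
    by (smt (verit))
  then show ?thesis
    using C w_nonneg[of 0] by (cases n) auto
qed

text \<open>
  The discrete core of the increasing case, with \<open>p k\<close> for the rate at time \<open>\<tau> k\<close>. A step can
  increase \<open>a\<close> by more than \<open>c\<close> only to the extent that \<open>p\<close> grows during it, by at most
  \<open>c (p (k + 1) - p k) / p k\<close>. If nevertheless \<open>a\<close> grows at speed \<open>d > c\<close>, these excesses sum to
  at least \<open>(d - c) n\<close> over the first \<open>n\<close> steps, up to a constant. By \<open>abel_lower_bound\<close> the
  comparison persists under the decreasing weights \<open>1 / p (k + 1)\<close>, and so weighted the excesses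
  telescope to at most \<open>c / p 0\<close>. So \<open>\<Sum> 1 / p k\<close> is finite, and it dominates the steps.
\<close>

lemma bounded_times_of_superlinear_growth:
  fixes a p \<tau> :: "nat \<Rightarrow> real"
  assumes p_pos: "\<And>k. p k > 0" and "mono p"
    and step: "\<And>k. (\<tau> (Suc k) - \<tau> k) * p k \<le> c"
    and incr: "\<And>k. a (Suc k) - a k \<le> (\<tau> (Suc k) - \<tau> k) * p (Suc k)"
    and growth: "\<And>k. a k \<ge> d * real k - C"
    and c: "0 \<le> c" "c < d"
  shows "\<exists>B. \<forall>k. \<tau> k \<le> B"
proof -
  define u where "u j = c * (p (Suc j) / p j - 1) - (d - c)" for j
  define w where "w j = 1 / p (Suc j)" for j
  have \<tau>_step: "\<tau> (Suc k) - \<tau> k \<le> c / p k" for k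
    using step[of k] p_pos[of k] by (simp add: pos_le_divide_eq)
  have "(\<Sum>j<n. u j) \<ge> - (C + a 0)" for n
  proof -
    have "a (Suc j) - a j - d \<le> u j" for j
    proof -
      have "a (Suc j) - a j \<le> c / p j * p (Suc j)"
        using incr[of j] mult_right_mono[OF \<tau>_step[of j], of "p (Suc j)"] p_pos[of "Suc j"] by simp
      then show ?thesis by (simp add: u_def algebra_simps)
    qed
    then have "(\<Sum>j<n. a (Suc j) - a j - d) \<le> (\<Sum>j<n. u j)"
      by (rule sum_mono)
    moreover have "(\<Sum>j<n. a (Suc j) - a j - d) = a n - a 0 - d * real n"
      using sum_lessThan_telescope[of a n] by (simp add: sum_subtractf mult.commute)
    ultimately have "a n - a 0 - d * real n \<le> (\<Sum>j<n. u j)"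
      by simp
    then show ?thesis using growth[of n] by simp
  qed
  moreover have "antimono w"
    unfolding w_def antimono_def
    using p_pos monoD[OF \<open>mono p\<close>] by (auto intro!: divide_left_mono)
  moreover have w_pos: "w j > 0" for j
    using p_pos by (simp add: w_def)
  ultimately have abel: "(\<Sum>j<n. w j * u j) \<ge> - ((C + a 0) * w 0)" for n
    by (intro abel_lower_bound) (auto intro: less_imp_le)
  have w_sum: "(d - c) * (\<Sum>j<n. w j) \<le> c / p 0 + (C + a 0) * w 0" for n
  proof -
    have "w j * u j = c * (1 / p j - 1 / p (Suc j)) - (d - c) * w j" for j
      using p_pos[of j] p_pos[of "Suc j"] by (simp add: u_def w_def field_simps)
    then have "(\<Sum>j<n. w j * u j) = c * (\<Sum>j<n. 1 / p j - 1 / p (Suc j)) - (d - c) * (\<Sum>j<n. w j)"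
      by (simp only: sum_subtractf sum_distrib_left right_diff_distrib[of c])
    also have "(\<Sum>j<n. 1 / p j - 1 / p (Suc j)) = 1 / p 0 - 1 / p n"
      by (rule sum_lessThan_telescope')
    finally have "(\<Sum>j<n. w j * u j) = c / p 0 - c / p n - (d - c) * (\<Sum>j<n. w j)"
      by (simp add: algebra_simps)
    moreover have "c / p n \<ge> 0"
      using c p_pos[of n] by simp
    ultimately show ?thesis
      using abel[of n] by linarith
  qed
  have \<tau>_bound: "\<tau> (Suc n) \<le> \<tau> 1 + c * ((c / p 0 + (C + a 0) * w 0) / (d - c))" for n
  proof -
    have "\<tau> (Suc n) - \<tau> 1 = (\<Sum>j<n. \<tau> (Suc (Suc j)) - \<tau> (Suc j))"
      using sum_lessThan_telescope[of "\<lambda>j. \<tau> (Suc j)" n] by simp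
    also have "\<dots> \<le> (\<Sum>j<n. c * w j)"
      using \<tau>_step by (intro sum_mono) (simp add: w_def)
    also have "\<dots> = c * (\<Sum>j<n. w j)"
      by (simp add: sum_distrib_left)
    also have "\<dots> \<le> c * ((c / p 0 + (C + a 0) * w 0) / (d - c))"
      using w_sum[of n] c by (intro mult_left_mono) (simp_all add: pos_le_divide_eq mult.commute)
    finally show ?thesis by simp
  qed
  have "\<tau> k \<le> max (\<tau> 0) (\<tau> 1 + c * ((c / p 0 + (C + a 0) * w 0) / (d - c)))" for k
    using \<tau>_bound by (cases k) (auto simp: le_max_iff_disj)
  then show ?thesis by blast
qed

section \<open>Time rescaling along a sequence of steps\<close>

lemma rate_has_real_derivative:
  assumes "time_rescaling \<alpha>" "s \<ge> 0"
  shows "(\<alpha> has_real_derivative rate \<alpha> s) (at s within {0..})"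
  using assms vector_derivative_works[of \<alpha> "at s within {0..}"]
  by (auto simp: time_rescaling_def rate_def differentiable_on_def
      has_real_derivative_iff_has_vector_derivative)

text \<open>The mean value \<open>s\<close> is an interior point, but \<open>a\<close> may be \<open>0\<close>, where \<open>rate\<close> is a one-sided
  derivative; the mean value theorem is therefore used with derivatives relative to \<open>{a..b}\<close>.\<close>

lemma rate_mean_value:
  assumes \<alpha>: "time_rescaling \<alpha>" and "0 \<le> a" "a < b"
  obtains s where "a < s" "s < b" "\<alpha> b - \<alpha> a = (b - a) * rate \<alpha> s"
proof -
  have "\<exists>s\<in>{a<..<b}. \<alpha> b - \<alpha> a = (b - a) * rate \<alpha> s"
  proof -
    have "(\<alpha> has_derivative (\<lambda>x. x * rate \<alpha> s)) (at s within {a..b})" if "s \<in> {a..b}" for s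
    proof -
      have "(\<alpha> has_real_derivative rate \<alpha> s) (at s within {a..b})"
        using rate_has_real_derivative[OF \<alpha>, of s] that \<open>0 \<le> a\<close>
        by (auto intro: DERIV_subset)
      then show ?thesis
        by (simp add: has_field_derivative_def mult.commute[of _ "rate \<alpha> s"])
    qed
    then show ?thesis
      using mvt_simple[OF \<open>a < b\<close>, of \<alpha> "\<lambda>s x. x * rate \<alpha> s"] by auto
  qed
  then show ?thesis using that by auto
qed

lemma rate_nonneg:
  assumes \<alpha>: "time_rescaling \<alpha>" and "s \<ge> 0"
  shows "rate \<alpha> s \<ge> 0"
proof (rule tendsto_lowerbound)
  have mono: "mono_on {0..} \<alpha>"
    using \<alpha> by (simp add: time_rescaling_def)
  show "((\<lambda>x. (\<alpha> x - \<alpha> s) / (x - s)) \<longlongrightarrow> rate \<alpha> s) (at s within {0..})"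
    using rate_has_real_derivative[OF assms] by (simp add: has_field_derivative_iff)
  have "(\<alpha> x - \<alpha> s) / (x - s) \<ge> 0" if "x \<in> {0..}" "x \<noteq> s" for x
  proof (cases "x < s")
    case True
    then have "\<alpha> x \<le> \<alpha> s"
      using that \<open>s \<ge> 0\<close> by (intro monotone_onD[OF mono]) auto
    with True show ?thesis by (simp add: divide_nonpos_neg)
  next
    case False
    then have "\<alpha> s \<le> \<alpha> x"
      using that \<open>s \<ge> 0\<close> by (intro monotone_onD[OF mono]) auto
    with False show ?thesis by simp
  qed
  then show "\<forall>\<^sub>F x in at s within {0..}. 0 \<le> (\<alpha> x - \<alpha> s) / (x - s)"
    by (auto simp: eventually_at intro!: exI[of _ 1])
  show "at s within {0..} \<noteq> bot"
  proof -
    have "{s<..} \<subseteq> {0..}"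
      using \<open>s \<ge> 0\<close> by (intro subsetI) simp
    then show ?thesis
      using at_le[of "{s<..}" "{0..}" s] trivial_limit_at_right_real[of s]
      by (auto simp: bot_unique)
  qed
qed

text \<open>
  Where the rate decreases, it is largest at the beginning of a step, so that each step advances
  \<open>\<alpha>\<close> by at most \<open>c\<close>. Where it increases, it can be much larger at the end of a step than at its
  beginning, and \<open>\<alpha> (t k)\<close> may well exceed \<open>d k\<close> for long periods; if it did so forever, the times
  would stay bounded.
\<close>

lemma frequently_rescaled_time_le:
  fixes t :: "nat \<Rightarrow> real"
  assumes \<alpha>: "time_rescaling \<alpha>"
    and monotonic: "mono_on {0..} (rate \<alpha>) \<or> antimono_on {0..} (rate \<alpha>)"
    and "strict_mono t" and t_nonneg: "\<And>k. t k \<ge> 0"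
    and t_infinity: "filterlim t at_top sequentially"
    and step: "\<And>k. k \<ge> k0 \<Longrightarrow> (t (Suc k) - t k) * rate \<alpha> (t k) \<le> c"
    and c: "0 \<le> c" "c < d"
  shows "\<exists>\<^sub>F k in sequentially. \<alpha> (t k) \<le> d * real k"
proof (rule ccontr)
  let ?p = "\<lambda>k. rate \<alpha> (t k)"
  have t_less: "t k < t (Suc k)" for k
    using \<open>strict_mono t\<close> by (simp add: strict_mono_Suc_iff)
  assume "\<not> (\<exists>\<^sub>F k in sequentially. \<alpha> (t k) \<le> d * real k)"
  then obtain K where K: "\<alpha> (t k) > d * real k" if "k \<ge> K" for k
    by (auto simp: not_frequently eventually_sequentially not_le)
  show False
    using monotonic
  proof
    assume anti: "antimono_on {0..} (rate \<alpha>)"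
    define N where "N = max K k0"
    have incr: "\<alpha> (t (Suc k)) - \<alpha> (t k) \<le> c" if "k \<ge> N" for k
    proof -
      obtain s where s: "t k < s" "\<alpha> (t (Suc k)) - \<alpha> (t k) = (t (Suc k) - t k) * rate \<alpha> s"
        using rate_mean_value[OF \<alpha> t_nonneg t_less] by metis
      have "rate \<alpha> s \<le> ?p k"
        using s(1) t_nonneg[of k] by (intro monotone_onD[OF anti]) auto
      then have "(t (Suc k) - t k) * rate \<alpha> s \<le> (t (Suc k) - t k) * ?p k"
        using t_less[of k] by (intro mult_left_mono) auto
      with s(2) step[of k] that show ?thesis
        by (simp add: N_def)
    qed
    have upper: "\<alpha> (t (N + k)) \<le> \<alpha> (t N) + c * real k" for k
    proof (induction k)
      case (Suc k)
      then show ?case using incr[of "N + k"] by (simp add: algebra_simps)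
    qed simp
    obtain k :: nat where "(\<alpha> (t N)) / (d - c) < real k"
      using reals_Archimedean2 by blast
    then have "\<alpha> (t N) + c * real k < d * real k"
      using c by (simp add: pos_divide_less_eq algebra_simps)
    also have "\<dots> \<le> d * real (N + k)"
      using c by simp
    also have "\<dots> < \<alpha> (t (N + k))"
      by (rule K) (simp add: N_def)
    finally show False using upper[of k] by simp
  next
    assume mono: "mono_on {0..} (rate \<alpha>)"
    \<comment> \<open>The rate is positive somewhere, as \<open>\<alpha>\<close> is not constant, and from there on.\<close>
    obtain s0 where s0: "s0 \<ge> 0" "rate \<alpha> s0 > 0"
    proof -
      have "\<forall>\<^sub>F b in at_top. \<alpha> b > 0 \<and> b > 0"
        using \<alpha> unfolding time_rescaling_def filterlim_at_top_dense
        by (intro eventually_conj eventually_gt_at_top) blast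
      then obtain b where "b > 0" "\<alpha> b > 0"
        using eventually_happens'[OF trivial_limit_at_top_linorder] by blast
      moreover obtain s where "0 < s" "\<alpha> b - \<alpha> 0 = (b - 0) * rate \<alpha> s"
        using rate_mean_value[OF \<alpha> order_refl \<open>b > 0\<close>] by metis
      ultimately show ?thesis
        using \<alpha> that[of s] by (auto simp: time_rescaling_def zero_less_mult_iff)
    qed
    obtain M where M: "t k \<ge> s0" if "k \<ge> M" for k
      using t_infinity by (auto simp: filterlim_at_top eventually_sequentially)
    define N where "N = max M (max K k0)"
    have "\<exists>B. \<forall>k. t (N + k) \<le> B"
    proof (rule bounded_times_of_superlinear_growth)
      show "?p (N + k) > 0" for k
        using s0 M[of "N + k"] monotone_onD[OF mono, of s0 "t (N + k)"] t_nonneg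
        by (force simp: N_def)
      show "monotone (\<le>) (\<le>) (\<lambda>k. ?p (N + k))"
        using strict_mono_less_eq[OF \<open>strict_mono t\<close>] t_nonneg
        by (intro monotoneI monotone_onD[OF mono]) auto
      show "(t (N + Suc k) - t (N + k)) * ?p (N + k) \<le> c" for k
        using step[of "N + k"] by (simp add: N_def)
      show "\<alpha> (t (N + Suc k)) - \<alpha> (t (N + k)) \<le> (t (N + Suc k) - t (N + k)) * ?p (N + Suc k)" for k
      proof -
        obtain s where s: "t (N + k) < s" "s < t (N + Suc k)"
          "\<alpha> (t (N + Suc k)) - \<alpha> (t (N + k)) = (t (N + Suc k) - t (N + k)) * rate \<alpha> s"
          using rate_mean_value[OF \<alpha> t_nonneg t_less[of "N + k"]] by (metis add_Suc_right)
        then have "rate \<alpha> s \<le> ?p (N + Suc k)"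
          using t_nonneg[of "N + k"] by (intro monotone_onD[OF mono]) auto
        with s show ?thesis
          by (auto intro: mult_left_mono)
      qed
      show "\<alpha> (t (N + k)) \<ge> d * real k - 0" for k
      proof -
        have "d * real k \<le> d * real (N + k)"
          using c by simp
        also have "\<dots> < \<alpha> (t (N + k))"
          by (rule K) (simp add: N_def)
        finally show ?thesis by simp
      qed
    qed (use c in auto)
    then obtain B where B: "\<And>k. t (N + k) \<le> B" by blast
    obtain m where "t k > B" if "k \<ge> m" for k
      using t_infinity by (auto simp: filterlim_at_top_dense eventually_sequentially)
    then show False
      using B[of m] by (meson le_add2 not_le)
  qed
qed

section \<open>Spectral radius of the rescaled dynamics\<close>

text \<open>The spectral radius is attained at an eigenvalue \<open>z\<close> of \<open>A\<close>, and \<open>c z\<close> is an eigenvalue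
  of \<open>c A\<close>.\<close>

lemma spectral_radius_scaled_le:
  fixes A :: "real ^ 'n::enum ^ 'n::enum"
  assumes "c \<ge> 0" and bound: "\<And>z. z \<in> spectrum (to_cmat (c *\<^sub>R A)) \<Longrightarrow> cmod z \<le> r"
  shows "c * spectral_radius (to_cmat A) \<le> r"
proof -
  have carrier: "to_cmat A \<in> carrier_mat CARD('n) CARD('n)"
    by (simp add: to_cmat_def)
  obtain z v where ev: "eigenvector (to_cmat A) v z" and z: "cmod z = spectral_radius (to_cmat A)"
    using spectral_radius_mem_max(1)[OF carrier zero_less_card_finite]
    by (auto simp: spectrum_def eigenvalue_def)
  have scaled: "to_cmat (c *\<^sub>R A) = complex_of_real c \<cdot>\<^sub>m to_cmat A"
    by (rule eq_matI) (auto simp: to_cmat_def)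
  have v: "v \<in> carrier_vec CARD('n)"
    using ev carrier by (auto simp: eigenvector_def)
  have "(complex_of_real c \<cdot>\<^sub>m to_cmat A) *\<^sub>v v = complex_of_real c \<cdot>\<^sub>v (to_cmat A *\<^sub>v v)"
    using carrier v by (intro eq_vecI) auto
  then have "eigenvector (to_cmat (c *\<^sub>R A)) v (complex_of_real c * z)"
    using ev carrier unfolding scaled eigenvector_def by (auto simp: smult_smult_assoc)
  then have "cmod (complex_of_real c * z) \<le> r"
    by (intro bound) (auto simp: spectrum_def eigenvalue_def)
  then show ?thesis
    using \<open>c \<ge> 0\<close> z by (simp add: norm_mult)
qed

text \<open>Differentiability is assumed of \<open>g\<close> because that of the rescaled field does not imply it
  where the rate vanishes.\<close>

lemma jac_rescale:
  assumes "jac_exists (g f) y (\<alpha> s)"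
  shows "jac (rescale \<alpha> g f) y s = rate \<alpha> s *\<^sub>R jac (g f) y (\<alpha> s)"
proof -
  let ?G = "\<lambda>z. g f z (\<alpha> s)"
  have "(?G has_derivative frechet_derivative ?G (at y)) (at y)"
    using assms by (simp add: jac_exists_def frechet_derivative_works)
  then have "((\<lambda>z. rate \<alpha> s *\<^sub>R ?G z) has_derivative
      (\<lambda>x. rate \<alpha> s *\<^sub>R frechet_derivative ?G (at y) x)) (at y)"
    by (rule has_derivative_scaleR_right)
  then have "frechet_derivative (\<lambda>z. rate \<alpha> s *\<^sub>R ?G z) (at y) =
      (\<lambda>x. rate \<alpha> s *\<^sub>R frechet_derivative ?G (at y) x)"
    by (rule frechet_derivative_at[symmetric])
  then show ?thesis
    by (simp add: jac_def jacobian_def rescale_def matrix_def Finite_Cartesian_Product.vec_eq_iff)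
qed

text \<open>
  The steps are common to all problems, so the restriction that stability imposes on them for one
  problem with spectral radius almost 1 suffices. Half of \<open>\<epsilon>\<close> pays for that radius being less
  than 1, and the other half is the margin \<open>d - c\<close> of \<open>frequently_rescaled_time_le\<close>.
\<close>

theorem theorem2:
  fixes \<F> :: "('d::enum) objective set"
    and fstar :: "'d objective \<Rightarrow> real"
    and \<V> :: "('n::enum) pt set"
    and g g1 ghat :: "('d, 'n) dynamics"
    and \<alpha> :: "real \<Rightarrow> real"
    and \<Phi> :: one_step_method
    and R :: "complex \<Rightarrow> complex option"
    and S :: "complex set"
    and r :: real
    and h t :: "nat \<Rightarrow> real"
    and Y :: "'d objective \<Rightarrow> 'n pt \<Rightarrow> nat \<Rightarrow> 'n pt"
  assumes dim: "CARD('d) dvd CARD('n)"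
    and objectives: "objective_collection \<F> fstar"
    and g: "g \<in> admissible \<F> fstar \<V>"
    and g1: "g1 \<in> rescaling_rel \<F> fstar \<V> `` {g}" "essential \<F> fstar \<V> 1 g1"
    and alpha: "time_rescaling \<alpha>"
    and rate_monotonic: "mono_on {0..} (rate \<alpha>) \<or> antimono_on {0..} (rate \<alpha>)"
    and ghat: "ghat = rescale \<alpha> g1"
    and R: "stability_function \<Phi> R"
    and S: "S = stability_domain R"
    and h_pos: "\<And>k. k \<ge> 1 \<Longrightarrow> h k > 0"
    and t: "\<And>k. t k = (\<Sum>i=1..k. h i)"
    and Y: "\<And>f y0. f \<in> \<F> \<Longrightarrow> y0 \<in> \<V> \<Longrightarrow> numerical_solution \<Phi> h t (ghat f) y0 (Y f y0)"
    and S_bounded: "bounded S"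
    and r: "r = (SUP z\<in>S. cmod z)"
    and eigenvalues_in_S: "\<And>f y0 k. f \<in> \<F> \<Longrightarrow> y0 \<in> \<V> \<Longrightarrow> k \<ge> 1 \<Longrightarrow>
      jac_exists (ghat f) (Y f y0 (k - 1)) (t (k - 1)) \<and>
      spectrum (to_cmat (h k *\<^sub>R jac (ghat f) (Y f y0 (k - 1)) (t (k - 1)))) \<subseteq> S"
    and t_infinity: "filterlim t at_top sequentially"
    and radius_near_1: "\<And>\<epsilon>0. \<epsilon>0 > 0 \<Longrightarrow> \<exists>f\<in>\<F>. \<exists>y0\<in>\<V>. \<exists>k0>0. \<forall>k\<ge>k0.
      jac_exists (g1 f) (Y f y0 k) (\<alpha> (t k)) \<and>
      spectral_radius (to_cmat (jac (g1 f) (Y f y0 k) (\<alpha> (t k)))) \<ge> 1 - \<epsilon>0"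
  shows "\<forall>\<epsilon>>0. \<exists>l :: nat \<Rightarrow> nat. strict_mono l \<and>
    (\<forall>j. \<alpha> (t (l j)) \<le> r * real (l j) + \<epsilon> * real (l j))"
proof (intro allI impI)
  fix \<epsilon> :: real assume \<epsilon>: "\<epsilon> > 0"
  let ?p = "\<lambda>k. rate \<alpha> (t k)"
  have t_Suc: "t (Suc k) = t k + h (Suc k)" for k
    by (simp add: t)
  have "strict_mono t"
    using h_pos by (simp add: strict_mono_Suc_iff t_Suc)
  have t_nonneg: "t k \<ge> 0" for k
    unfolding t by (rule sum_nonneg) (simp add: h_pos less_imp_le)
  have S_le: "cmod z \<le> r" if "z \<in> S" for z
  proof -
    have "bdd_above (cmod ` S)"
      using S_bounded by (auto simp: bounded_iff bdd_above_def)
    then show ?thesis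
      unfolding r using that by (rule cSUP_upper[rotated])
  qed

  have step_radius: "h (Suc k) * ?p k * spectral_radius (to_cmat (jac (g1 f) (Y f y0 k) (\<alpha> (t k)))) \<le> r"
    if "f \<in> \<F>" "y0 \<in> \<V>" "jac_exists (g1 f) (Y f y0 k) (\<alpha> (t k))" for f y0 k
  proof (rule spectral_radius_scaled_le)
    show "0 \<le> h (Suc k) * ?p k"
      using h_pos[of "Suc k"] rate_nonneg[OF alpha t_nonneg[of k]] by simp
    have "h (Suc k) *\<^sub>R jac (ghat f) (Y f y0 k) (t k) =
        (h (Suc k) * ?p k) *\<^sub>R jac (g1 f) (Y f y0 k) (\<alpha> (t k))"
      using jac_rescale[of g1 f "Y f y0 k" \<alpha> "t k", OF that(3)] by (simp add: ghat)
    then show "cmod z \<le> r"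
      if "z \<in> spectrum (to_cmat ((h (Suc k) * ?p k) *\<^sub>R jac (g1 f) (Y f y0 k) (\<alpha> (t k))))" for z
      using eigenvalues_in_S[OF \<open>f \<in> \<F>\<close> \<open>y0 \<in> \<V>\<close>, of "Suc k"] that by (auto intro: S_le)
  qed

  \<comment> \<open>A special case of the near-1 condition: with \<open>\<epsilon>0 = 1\<close> it yields a nonnegative radius.\<close>
  have r_nonneg: "r \<ge> 0"
  proof -
    obtain f y0 k0 where f: "f \<in> \<F>" "y0 \<in> \<V>"
      and "\<forall>k\<ge>k0. jac_exists (g1 f) (Y f y0 k) (\<alpha> (t k)) \<and>
        spectral_radius (to_cmat (jac (g1 f) (Y f y0 k) (\<alpha> (t k)))) \<ge> 1 - 1"
      using radius_near_1[OF zero_less_one_class.zero_less_one] by blast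
    then have k0: "jac_exists (g1 f) (Y f y0 k0) (\<alpha> (t k0))"
        "spectral_radius (to_cmat (jac (g1 f) (Y f y0 k0) (\<alpha> (t k0)))) \<ge> 0"
      by auto
    have "0 \<le> h (Suc k0) * ?p k0 * spectral_radius (to_cmat (jac (g1 f) (Y f y0 k0) (\<alpha> (t k0))))"
      using h_pos[of "Suc k0"] rate_nonneg[OF alpha t_nonneg[of k0]] k0(2) by simp
    with step_radius[OF f k0(1)] show ?thesis by linarith
  qed

  define c where "c = r + \<epsilon> / 2"
  define d where "d = r + \<epsilon>"
  have c: "0 \<le> c" "c < d"
    using r_nonneg \<epsilon> by (auto simp: c_def d_def)
  obtain k0 where step: "h (Suc k) * ?p k \<le> c" if "k \<ge> k0" for k
  proof -
    \<comment> \<open>Chosen so that \<open>c (1 - \<epsilon>0) = c\<^sup>2 / (r + \<epsilon>)\<close>, which is at least \<open>r\<close>; the denominator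
      remains positive for \<open>r = 0\<close>.\<close>
    define \<epsilon>0 where "\<epsilon>0 = \<epsilon> / 2 / (r + \<epsilon>)"
    have \<epsilon>0: "0 < \<epsilon>0" "\<epsilon>0 < 1" "r \<le> c * (1 - \<epsilon>0)"
      using r_nonneg \<epsilon> by (auto simp: \<epsilon>0_def c_def field_simps)
    obtain f y0 k0 where f: "f \<in> \<F>" "y0 \<in> \<V>"
      and k0: "\<forall>k\<ge>k0. jac_exists (g1 f) (Y f y0 k) (\<alpha> (t k)) \<and>
        spectral_radius (to_cmat (jac (g1 f) (Y f y0 k) (\<alpha> (t k)))) \<ge> 1 - \<epsilon>0"
      using radius_near_1[OF \<epsilon>0(1)] by blast
    have "h (Suc k) * ?p k \<le> c" if "k \<ge> k0" for k
    proof -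
      have "h (Suc k) * ?p k * (1 - \<epsilon>0) \<le>
          h (Suc k) * ?p k * spectral_radius (to_cmat (jac (g1 f) (Y f y0 k) (\<alpha> (t k))))"
        using k0 that h_pos[of "Suc k"] rate_nonneg[OF alpha t_nonneg[of k]]
        by (intro mult_left_mono) auto
      also have "\<dots> \<le> c * (1 - \<epsilon>0)"
        using step_radius[OF f, of k] k0 that \<epsilon>0(3) by fastforce
      finally show ?thesis
        using \<epsilon>0(2) by simp
    qed
    then show ?thesis by (rule that)
  qed

  have "\<exists>\<^sub>F k in sequentially. \<alpha> (t k) \<le> d * real k"
    using step
    by (intro frequently_rescaled_time_le[OF alpha rate_monotonic \<open>strict_mono t\<close> t_nonneg
          t_infinity _ c]) (auto simp: t_Suc)
  then have inf: "infinite {k. \<alpha> (t k) \<le> d * real k}"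
    by (simp add: frequently_cofinite[symmetric] cofinite_eq_sequentially)
  show "\<exists>l :: nat \<Rightarrow> nat. strict_mono l \<and>
      (\<forall>j. \<alpha> (t (l j)) \<le> r * real (l j) + \<epsilon> * real (l j))"
    using infinite_enumerate[OF inf] by (auto simp: d_def algebra_simps)
qed

end
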